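(* Let $\kappa<0$. There are no isosceles relative equilibria parallel with the $xy$-plane in $\mathbb H_\kappa^2$ (for the curved 3-body problem with masses $m_1,m_2,m_3>0$), except for the Lagrangian (equilateral) solutions of equal masses, which occur on any circle of $\mathbb H_\kappa^2$ parallel with the $xy$-plane.
   Context: For $\kappa<0$ let $\mathbb H_\kappa^2=\{(x,y,z) : \kappa(x^2+y^2-z^2)+2|\kappa|^{1/2}z=0,\ z\ge0\}$, the upper sheet of a hyperboloid of two sheets, embedded in Minkowski space $\mathbb R^{2,1}$ with the Lorentz inner product of signature $(+,+,-)$. Bodies of masses $m_1,m_2,m_3$ have positions ${\bf r}_i=(x_i,y_i,z_i)\in\mathbb H_\kappa^2$. With $r_{ij}=[(x_i-x_j)^2+(y_i-y_j)^2-(z_i-z_j)^2]^{1/2}$ and $\dot{\bf r}_i\cdot\dot{\bf r}_i=\dot x_i^2+\dot y_i^2-\dot z_i^2$, the equations of motion of the curved 3-body problem are, for $i=1,2,3$, $$\ddot x_i=\sum_{j\ne i}\frac{m_j\big[x_j-\big(1-\frac{\kappa r_{ij}^2}{2}\big)x_i\big]}{r_{ij}^3\big(1-\frac{\kappa r_{ij}^2}{4}\big)^{3/2}}-\kappa(\dot{\bf r}_i\cdot\dot{\bf r}_i)x_i,$$ the same equation with $y$ in place of $x$, and $$\ddot z_i=\sum_{j\ne i}\frac{m_j\big[z_j-\big(1-\frac{\kappa r_{ij}^2}{2}\big)z_i-\frac{|\kappa|^{1/2}r_{ij}^2}{2}\big]}{r_{ij}^3\big(1-\frac{\kappa r_{ij}^2}{4}\big)^{3/2}}-(\dot{\bf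 r}_i\cdot\dot{\bf r}_i)(\kappa z_i-|\kappa|^{1/2}).$$ Collisions are excluded. A relative equilibrium parallel with the $xy$-plane is a solution of the form $x_i=\varrho\cos(\alpha t+a_i)$, $y_i=\varrho\sin(\alpha t+a_i)$, $z_i=v$, $i=1,2,3$, with constants $\alpha\neq0$, $v>0$, $a_i\in\mathbb R$, where $\varrho>0$ is determined by $\varrho^2=v^2+2|\kappa|^{-1/2}v$. It is isosceles if the triangle with vertices ${\bf r}_1,{\bf r}_2,{\bf r}_3$ has two equal sides, and Lagrangian if the triangle is equilateral. *)

theory Defs
  imports "HOL-Analysis.Analysis"
begin

definition lorentz :: "real ^ 3 \<Rightarrow> real ^ 3 \<Rightarrow> real" where
  "lorentz u w = u $ 1 * w $ 1 + u $ 2 * w $ 2 - u $ 3 * w $ 3"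

definition hyperboloid :: "real \<Rightarrow> (real ^ 3) set" where
  "hyperboloid \<kappa> = {p. \<kappa> * lorentz p p + 2 * sqrt \<bar>\<kappa>\<bar> * p $ 3 = 0 \<and> p $ 3 \<ge> 0}"

text \<open>Two points of the same sheet have spacelike or zero difference, so the radicand is
  nonnegative wherever this distance is used.\<close>

definition ldist :: "real ^ 3 \<Rightarrow> real ^ 3 \<Rightarrow> real" where
  "ldist p q = sqrt (lorentz (p - q) (p - q))"

definition denom :: "real \<Rightarrow> real ^ 3 \<Rightarrow> real ^ 3 \<Rightarrow> real" where
  "denom \<kappa> p q = ldist p q ^ 3 * (1 - \<kappa> * (ldist p q)\<^sup>2 / 4) powr (3/2)"

text \<open>Acceleration of body \<open>i\<close> for masses \<open>m\<close>, positions \<open>q\<close> and velocities \<open>u\<close>.  The three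
  bodies are indexed by the numeral type \<open>3\<close>, whose elements are \<open>1\<close>, \<open>2\<close> and \<open>3 = 0\<close>.\<close>

definition acceleration ::
  "real \<Rightarrow> (3 \<Rightarrow> real) \<Rightarrow> (3 \<Rightarrow> real ^ 3) \<Rightarrow> (3 \<Rightarrow> real ^ 3) \<Rightarrow> 3 \<Rightarrow> real ^ 3" where
  "acceleration \<kappa> m q u i = vector
    [(\<Sum>j\<in>UNIV - {i}. m j * (q j $ 1 - (1 - \<kappa> * (ldist (q i) (q j))\<^sup>2 / 2) * q i $ 1)
        / denom \<kappa> (q i) (q j))
       - \<kappa> * lorentz (u i) (u i) * q i $ 1,
     (\<Sum>j\<in>UNIV - {i}. m j * (q j $ 2 - (1 - \<kappa> * (ldist (q i) (q j))\<^sup>2 / 2) * q i $ 2)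
        / denom \<kappa> (q i) (q j))
       - \<kappa> * lorentz (u i) (u i) * q i $ 2,
     (\<Sum>j\<in>UNIV - {i}. m j * (q j $ 3 - (1 - \<kappa> * (ldist (q i) (q j))\<^sup>2 / 2) * q i $ 3
          - sqrt \<bar>\<kappa>\<bar> * (ldist (q i) (q j))\<^sup>2 / 2)
        / denom \<kappa> (q i) (q j))
       - lorentz (u i) (u i) * (\<kappa> * q i $ 3 - sqrt \<bar>\<kappa>\<bar>)]"

text \<open>Injectivity of the configuration at every time excludes collisions.\<close>

definition three_body_solution ::
  "real \<Rightarrow> (3 \<Rightarrow> real) \<Rightarrow> (3 \<Rightarrow> real \<Rightarrow> real ^ 3) \<Rightarrow> bool" where
  "three_body_solution \<kappa> m r \<longleftrightarrow>
     (\<forall>i t. r i t \<in> hyperboloid \<kappa>) \<and>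
     (\<forall>t. inj (\<lambda>i. r i t)) \<and>
     (\<exists>r'. \<forall>i t.
        (r i has_vector_derivative r' i t) (at t) \<and>
        (r' i has_vector_derivative acceleration \<kappa> m (\<lambda>j. r j t) (\<lambda>j. r' j t) i) (at t))"

text \<open>The parameter \<open>v\<close> is the height of the common circle.\<close>

definition parallel_relative_equilibrium ::
  "real \<Rightarrow> (3 \<Rightarrow> real) \<Rightarrow> real \<Rightarrow> (3 \<Rightarrow> real \<Rightarrow> real ^ 3) \<Rightarrow> bool" where
  "parallel_relative_equilibrium \<kappa> m v r \<longleftrightarrow>
     three_body_solution \<kappa> m r \<and> v > 0 \<and>
     (\<exists>\<alpha> \<rho> a. \<alpha> \<noteq> 0 \<and> \<rho> > 0 \<and> \<rho>\<^sup>2 = v\<^sup>2 + 2 / sqrt \<bar>\<kappa>\<bar> * v \<and>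
        (\<forall>i t. r i t = vector [\<rho> * cos (\<alpha> * t + a i), \<rho> * sin (\<alpha> * t + a i), v]))"

definition isosceles :: "(3 \<Rightarrow> real \<Rightarrow> real ^ 3) \<Rightarrow> bool" where
  "isosceles r \<longleftrightarrow> (\<forall>t. \<exists>i j k. i \<noteq> j \<and> j \<noteq> k \<and> i \<noteq> k \<and>
     ldist (r i t) (r j t) = ldist (r i t) (r k t))"

definition lagrangian :: "(3 \<Rightarrow> real \<Rightarrow> real ^ 3) \<Rightarrow> bool" where
  "lagrangian r \<longleftrightarrow> (\<forall>t. ldist (r 1 t) (r 2 t) = ldist (r 2 t) (r 3 t) \<and>
     ldist (r 2 t) (r 3 t) = ldist (r 3 t) (r 1 t))"

end

theory Submission
  imports Defs
begin

text \<open>On a circle at height \<open>v\<close> the squared distance of two bodies is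
  \<open>2 \<rho>\<^sup>2 (1 - cos (a\<^sub>i - a\<^sub>j))\<close>, and in the rotating frame the equations of motion reduce to
  \<open>\<Sum> m\<^sub>j (1 - cos (a\<^sub>i - a\<^sub>j)) / D\<^sub>i\<^sub>j = \<alpha>\<^sup>2\<close> and \<open>\<Sum> m\<^sub>j sin (a\<^sub>j - a\<^sub>i) / D\<^sub>i\<^sub>j = 0\<close> for each \<open>i\<close>.
  If the bodies \<open>j\<close>, \<open>k\<close> lie at angles \<open>\<plusminus>\<phi>\<close> from \<open>i\<close>, the second equation at \<open>i\<close> gives
  \<open>m\<^sub>j = m\<^sub>k\<close> and at \<open>j\<close> gives \<open>m\<^sub>i D\<^sub>j\<^sub>k = - 2 m\<^sub>j cos \<phi> D\<^sub>i\<^sub>j\<close>; equating the first one at \<open>i\<close> and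
  at \<open>j\<close> then leaves \<open>D\<^sub>i\<^sub>j = D\<^sub>j\<^sub>k\<close>.  Since \<open>D\<close> is strictly increasing in the distance, the
  triangle is equilateral, and the masses are equal.\<close>

section \<open>The force denominator as a function of the squared distance\<close>

definition radial_denom :: "real \<Rightarrow> real \<Rightarrow> real" where
  "radial_denom \<kappa> w = sqrt w ^ 3 * (1 - \<kappa> * w / 4) powr (3/2)"

lemma denom_eq_radial_denom:
  assumes "0 \<le> lorentz (p - q) (p - q)"
  shows "denom \<kappa> p q = radial_denom \<kappa> (lorentz (p - q) (p - q))"
  using assms by (simp add: denom_def ldist_def radial_denom_def)

text \<open>Negative curvature is decisive: \<open>1 - \<kappa> * w / 4\<close> then grows with
  \<open>w\<close>, as \<open>sqrt w ^ 3\<close> does, and both factors are nonnegative. For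
  \<kappa> > 0 the second factor would decrease.\<close>

lemma radial_denom_strict_mono:
  assumes "\<kappa> < 0" "0 \<le> w" "w < w'"
  shows "radial_denom \<kappa> w < radial_denom \<kappa> w'"
proof -
  have *: "\<kappa> * w' < \<kappa> * w" "\<kappa> * w \<le> 0"
    using assms by (auto simp: mult_nonpos_nonneg)
  have "sqrt w ^ 3 < sqrt w' ^ 3"
    using assms by (intro power_strict_mono) auto
  moreover have "(1 - \<kappa> * w / 4) powr (3/2) < (1 - \<kappa> * w' / 4) powr (3/2)"
    using * by (intro powr_less_mono2) auto
  ultimately show ?thesis
    unfolding radial_denom_def using assms by (intro mult_strict_mono) auto
qed

lemma radial_denom_pos: "\<kappa> < 0 \<Longrightarrow> 0 < w \<Longrightarrow> 0 < radial_denom \<kappa> w"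
  using radial_denom_strict_mono[of \<kappa> 0 w] by (simp add: radial_denom_def)

section \<open>Lorentz geometry of a horizontal circle\<close>

definition circle_point :: "real \<Rightarrow> real \<Rightarrow> real \<Rightarrow> real ^ 3" where
  "circle_point \<rho> v \<theta> = vector [\<rho> * cos \<theta>, \<rho> * sin \<theta>, v]"

lemma circle_point_nth [simp]:
  "circle_point \<rho> v \<theta> $ 1 = \<rho> * cos \<theta>"
  "circle_point \<rho> v \<theta> $ 2 = \<rho> * sin \<theta>"
  "circle_point \<rho> v \<theta> $ 3 = v"
  by (simp_all add: circle_point_def)

text \<open>The heights cancel, so this is the Euclidean squared chord. It depends on the angles
  only through their difference, which a uniform rotation preserves.\<close>

lemma lorentz_diff_circle_point:
  "lorentz (circle_point \<rho> v \<theta> - circle_point \<rho> v \<phi>) (circle_point \<rho> v \<theta> - circle_point \<rho> v \<phi>)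
     = 2 * \<rho>\<^sup>2 * (1 - cos (\<theta> - \<phi>))"
proof -
  have "(cos \<theta>)\<^sup>2 + (sin \<theta>)\<^sup>2 = 1" "(cos \<phi>)\<^sup>2 + (sin \<phi>)\<^sup>2 = 1" by simp_all
  then show ?thesis
    unfolding lorentz_def cos_diff vector_minus_component circle_point_nth by algebra
qed

lemma ldist_circle_point:
  "ldist (circle_point \<rho> v \<theta>) (circle_point \<rho> v \<phi>) = sqrt (2 * \<rho>\<^sup>2 * (1 - cos (\<theta> - \<phi>)))"
  by (simp add: ldist_def lorentz_diff_circle_point)

lemma denom_circle_point:
  "denom \<kappa> (circle_point \<rho> v \<theta>) (circle_point \<rho> v \<phi>)
     = radial_denom \<kappa> (2 * \<rho>\<^sup>2 * (1 - cos (\<theta> - \<phi>)))"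
  by (simp add: denom_eq_radial_denom lorentz_diff_circle_point)

text \<open>Coinciding points have a chord of length zero. The cosine expresses equality of angles
  modulo a full turn, so collisions need no arithmetic modulo \<open>2 * pi\<close>.\<close>

lemma circle_point_eq_iff:
  assumes "\<rho> > 0"
  shows "circle_point \<rho> v \<theta> = circle_point \<rho> v \<phi> \<longleftrightarrow> cos (\<theta> - \<phi>) = 1"
proof
  assume "circle_point \<rho> v \<theta> = circle_point \<rho> v \<phi>"
  then show "cos (\<theta> - \<phi>) = 1"
    using lorentz_diff_circle_point[of \<rho> v \<theta> \<phi>] assms by (simp add: lorentz_def)
next
  assume c: "cos (\<theta> - \<phi>) = 1"
  then have s: "sin (\<theta> - \<phi>) = 0" by (rule cos_one_sin_zero)
  have "cos \<theta> = cos (\<phi> + (\<theta> - \<phi>))" "sin \<theta> = sin (\<phi> + (\<theta> - \<phi>))" by simp_all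
  then have "cos \<theta> = cos \<phi>" "sin \<theta> = sin \<phi>"
    unfolding cos_add sin_add c s by simp_all
  then show "circle_point \<rho> v \<theta> = circle_point \<rho> v \<phi>" by (simp add: circle_point_def)
qed

lemma circle_point_in_hyperboloid:
  assumes "\<kappa> < 0" "v > 0" "\<rho>\<^sup>2 = v\<^sup>2 + 2 / sqrt \<bar>\<kappa>\<bar> * v"
  shows "circle_point \<rho> v \<theta> \<in> hyperboloid \<kappa>"
proof -
  \<comment> \<open>In terms of \<open>s\<close> we have \<open>\<kappa> = - s\<^sup>2\<close>, and
    the equation of the surface becomes the cancellation of \<open>- 2 * s * v\<close> against
    \<open>2 * s * v\<close>.\<close>
  define s where "s = sqrt \<bar>\<kappa>\<bar>"
  have s: "s > 0" "\<kappa> = - s\<^sup>2" using assms(1) by (auto simp: s_def)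
  have "lorentz (circle_point \<rho> v \<theta>) (circle_point \<rho> v \<theta>)
      = \<rho>\<^sup>2 * ((cos \<theta>)\<^sup>2 + (sin \<theta>)\<^sup>2) - v\<^sup>2"
    unfolding lorentz_def circle_point_nth by algebra
  also have "\<dots> = 2 / s * v" using assms(3) by (simp add: s_def)
  finally show ?thesis
    using s assms(2) unfolding hyperboloid_def s_def[symmetric]
    by (simp add: power2_eq_square)
qed

lemma has_vector_derivative_vector_3:
  fixes f g h :: "real \<Rightarrow> real"
  assumes "(f has_real_derivative f') (at t)" "(g has_real_derivative g') (at t)"
    "(h has_real_derivative h') (at t)"
  shows "((\<lambda>t. vector [f t, g t, h t] :: real ^ 3) has_vector_derivative vector [f', g', h']) (at t)"
proof -
  have eq: "vector [x, y, z] = x *\<^sub>R axis 1 1 + y *\<^sub>R axis 2 1 + z *\<^sub>R (axis 3 1 :: real ^ 3)"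
    for x y z by (simp add: vec_eq_iff forall_3 axis_def)
  show ?thesis
    unfolding eq using assms
    by (auto intro!: derivative_eq_intros simp: has_real_derivative_iff_has_vector_derivative)
qed

section \<open>Equations of motion of a rigid rotation\<close>

context
  fixes \<kappa> v \<rho> \<alpha> :: real and m a :: "3 \<Rightarrow> real"
begin

definition pair_denom :: "3 \<Rightarrow> 3 \<Rightarrow> real" where
  "pair_denom i j = radial_denom \<kappa> (2 * \<rho>\<^sup>2 * (1 - cos (a i - a j)))"

text \<open>Up to the factors \<open>- (1 - \<kappa> * \<rho>\<^sup>2) * \<rho>\<close> and
  \<open>\<rho>\<close>, this sum and \<open>tangential_force\<close> are the components of the
  attraction on body \<open>i\<close> along the outward radius and the tangent of the
  circle.\<close>

definition radial_force :: "3 \<Rightarrow> real" where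
  "radial_force i = (\<Sum>j\<in>UNIV - {i}. m j * (1 - cos (a i - a j)) / pair_denom i j)"

definition tangential_force :: "3 \<Rightarrow> real" where
  "tangential_force i = (\<Sum>j\<in>UNIV - {i}. m j * sin (a j - a i) / pair_denom i j)"

definition rotation :: "3 \<Rightarrow> real \<Rightarrow> real ^ 3" where
  "rotation i t = circle_point \<rho> v (\<alpha> * t + a i)"

definition rotation_velocity :: "3 \<Rightarrow> real \<Rightarrow> real ^ 3" where
  "rotation_velocity i t =
     vector [- \<alpha> * \<rho> * sin (\<alpha> * t + a i), \<alpha> * \<rho> * cos (\<alpha> * t + a i), 0]"

lemma rotation_has_vector_derivative:
  "(rotation i has_vector_derivative rotation_velocity i t) (at t)"
  unfolding rotation_def[abs_def] rotation_velocity_def circle_point_def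
  by (intro has_vector_derivative_vector_3) (auto intro!: derivative_eq_intros)

lemma rotation_velocity_has_vector_derivative:
  "(rotation_velocity i has_vector_derivative
     vector [- \<alpha>\<^sup>2 * \<rho> * cos (\<alpha> * t + a i), - \<alpha>\<^sup>2 * \<rho> * sin (\<alpha> * t + a i), 0]) (at t)"
  unfolding rotation_velocity_def[abs_def]
  by (intro has_vector_derivative_vector_3)
     (auto intro!: derivative_eq_intros simp: power2_eq_square)

lemma lorentz_rotation_velocity:
  "lorentz (rotation_velocity i t) (rotation_velocity i t) = \<rho>\<^sup>2 * \<alpha>\<^sup>2"
proof -
  have "lorentz (rotation_velocity i t) (rotation_velocity i t)
     = \<rho>\<^sup>2 * \<alpha>\<^sup>2 * ((cos (\<alpha> * t + a i))\<^sup>2 + (sin (\<alpha> * t + a i))\<^sup>2)"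
    unfolding lorentz_def rotation_velocity_def vector_3 by algebra
  then show ?thesis by simp
qed

text \<open>Each position is resolved along the radius and tangent at body \<open>i\<close>. The
  factor \<open>1 - \<kappa> * \<rho>\<^sup>2\<close> collects the direct attraction and the
  curvature correction, both proportional to \<open>1 - cos (a i - a j)\<close>.\<close>

lemma acceleration_rotation:
  "acceleration \<kappa> m (\<lambda>j. rotation j t) (\<lambda>j. rotation_velocity j t) i = vector
     [- (1 - \<kappa> * \<rho>\<^sup>2) * \<rho> * cos (\<alpha> * t + a i) * radial_force i
        - \<rho> * sin (\<alpha> * t + a i) * tangential_force i - \<kappa> * \<rho>\<^sup>2 * \<alpha>\<^sup>2 * \<rho> * cos (\<alpha> * t + a i),
      - (1 - \<kappa> * \<rho>\<^sup>2) * \<rho> * sin (\<alpha> * t + a i) * radial_force i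
        + \<rho> * cos (\<alpha> * t + a i) * tangential_force i - \<kappa> * \<rho>\<^sup>2 * \<alpha>\<^sup>2 * \<rho> * sin (\<alpha> * t + a i),
      (sqrt \<bar>\<kappa>\<bar> - \<kappa> * v) * \<rho>\<^sup>2 * (\<alpha>\<^sup>2 - radial_force i)]"
proof -
  define \<theta> where "\<theta> j = \<alpha> * t + a j" for j
  have C: "cos (\<theta> j) = cos (\<theta> i) * cos (a i - a j) - sin (\<theta> i) * sin (a j - a i)" for j
    using cos_add[of "\<theta> i" "a j - a i"] cos_minus[of "a i - a j"] by (simp add: \<theta>_def)
  have S: "sin (\<theta> j) = sin (\<theta> i) * cos (a i - a j) + cos (\<theta> i) * sin (a j - a i)" for j
    using sin_add[of "\<theta> i" "a j - a i"] cos_minus[of "a i - a j"] by (simp add: \<theta>_def)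
  have d2: "\<kappa> * (ldist (rotation i t) (rotation j t))\<^sup>2 / 2 = \<kappa> * \<rho>\<^sup>2 * (1 - cos (a i - a j))"
    "sqrt \<bar>\<kappa>\<bar> * (ldist (rotation i t) (rotation j t))\<^sup>2 / 2
       = sqrt \<bar>\<kappa>\<bar> * \<rho>\<^sup>2 * (1 - cos (a i - a j))" for j
    by (simp_all add: rotation_def ldist_circle_point)
  have D: "denom \<kappa> (rotation i t) (rotation j t) = pair_denom i j" for j
    by (simp add: rotation_def denom_circle_point pair_denom_def)
  have nth: "rotation j t $ 1 = \<rho> * cos (\<theta> j)" "rotation j t $ 2 = \<rho> * sin (\<theta> j)"
    "rotation j t $ 3 = v" for j by (simp_all add: rotation_def \<theta>_def)
  have 1: "(\<Sum>j\<in>UNIV - {i}. m j * (\<rho> * cos (\<theta> j)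
        - (1 - \<kappa> * \<rho>\<^sup>2 * (1 - cos (a i - a j))) * (\<rho> * cos (\<theta> i))) / pair_denom i j)
      = - (1 - \<kappa> * \<rho>\<^sup>2) * \<rho> * cos (\<theta> i) * radial_force i - \<rho> * sin (\<theta> i) * tangential_force i"
    \<comment> \<open>With the inverse denominator as an atom, the termwise identity is polynomial
      and holds even where the denominator vanishes.\<close>
    unfolding radial_force_def tangential_force_def sum_distrib_left sum_subtractf[symmetric]
      divide_inverse
  proof (rule sum.cong[OF refl])
    fix j
    show "m j * (\<rho> * cos (\<theta> j)
        - (1 - \<kappa> * \<rho>\<^sup>2 * (1 - cos (a i - a j))) * (\<rho> * cos (\<theta> i))) * inverse (pair_denom i j)
      = - (1 - \<kappa> * \<rho>\<^sup>2) * \<rho> * cos (\<theta> i) * (m j * (1 - cos (a i - a j)) * inverse (pair_denom i j))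
        - \<rho> * sin (\<theta> i) * (m j * sin (a j - a i) * inverse (pair_denom i j))"
      using C[of j] by algebra
  qed
  have 2: "(\<Sum>j\<in>UNIV - {i}. m j * (\<rho> * sin (\<theta> j)
        - (1 - \<kappa> * \<rho>\<^sup>2 * (1 - cos (a i - a j))) * (\<rho> * sin (\<theta> i))) / pair_denom i j)
      = - (1 - \<kappa> * \<rho>\<^sup>2) * \<rho> * sin (\<theta> i) * radial_force i + \<rho> * cos (\<theta> i) * tangential_force i"
    unfolding radial_force_def tangential_force_def sum_distrib_left sum.distrib[symmetric]
      divide_inverse
  proof (rule sum.cong[OF refl])
    fix j
    show "m j * (\<rho> * sin (\<theta> j)
        - (1 - \<kappa> * \<rho>\<^sup>2 * (1 - cos (a i - a j))) * (\<rho> * sin (\<theta> i))) * inverse (pair_denom i j)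
      = - (1 - \<kappa> * \<rho>\<^sup>2) * \<rho> * sin (\<theta> i) * (m j * (1 - cos (a i - a j)) * inverse (pair_denom i j))
        + \<rho> * cos (\<theta> i) * (m j * sin (a j - a i) * inverse (pair_denom i j))"
      using S[of j] by algebra
  qed
  have 3: "(\<Sum>j\<in>UNIV - {i}. m j * (v - (1 - \<kappa> * \<rho>\<^sup>2 * (1 - cos (a i - a j))) * v
        - sqrt \<bar>\<kappa>\<bar> * \<rho>\<^sup>2 * (1 - cos (a i - a j))) / pair_denom i j)
      = - (sqrt \<bar>\<kappa>\<bar> - \<kappa> * v) * \<rho>\<^sup>2 * radial_force i"
    unfolding radial_force_def sum_distrib_left divide_inverse
    by (rule sum.cong[OF refl]) algebra
  show ?thesis
    unfolding acceleration_def d2 D nth lorentz_rotation_velocity 1 2 3 \<theta>_def[symmetric]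
    by (simp add: vec_eq_iff forall_3 algebra_simps)
qed

text \<open>Time drops out: the vertical equation fixes the radial sum, the horizontal radial
  equation then holds by itself, and the tangential equation is the only further condition.\<close>

lemma three_body_solution_rotation_iff:
  assumes "\<kappa> < 0" "v > 0" "\<rho> > 0" "\<rho>\<^sup>2 = v\<^sup>2 + 2 / sqrt \<bar>\<kappa>\<bar> * v"
  shows "three_body_solution \<kappa> m rotation \<longleftrightarrow>
    (\<forall>i j. i \<noteq> j \<longrightarrow> cos (a i - a j) \<noteq> 1) \<and>
    (\<forall>i. radial_force i = \<alpha>\<^sup>2 \<and> tangential_force i = 0)"
proof -
  have hyp: "rotation i t \<in> hyperboloid \<kappa>" for i t
    unfolding rotation_def using circle_point_in_hyperboloid assms by blast
  have inj: "inj (\<lambda>i. rotation i t) \<longleftrightarrow> (\<forall>i j. i \<noteq> j \<longrightarrow> cos (a i - a j) \<noteq> 1)" for t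
    unfolding inj_def rotation_def circle_point_eq_iff[OF assms(3)] by auto
  let ?acc = "\<lambda>i t. acceleration \<kappa> m (\<lambda>j. rotation j t) (\<lambda>j. rotation_velocity j t) i"
  let ?w = "\<lambda>i t. vector [- \<alpha>\<^sup>2 * \<rho> * cos (\<alpha> * t + a i), - \<alpha>\<^sup>2 * \<rho> * sin (\<alpha> * t + a i), 0] :: real ^ 3"
  have der: "(\<exists>r'. \<forall>i t. (rotation i has_vector_derivative r' i t) (at t) \<and>
        (r' i has_vector_derivative acceleration \<kappa> m (\<lambda>j. rotation j t) (\<lambda>j. r' j t) i) (at t))
      \<longleftrightarrow> (\<forall>i t. ?acc i t = ?w i t)" (is "?L \<longleftrightarrow> ?R")
  proof
    assume ?L
    then obtain r' where r':
      "\<And>i t. (rotation i has_vector_derivative r' i t) (at t)"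
      "\<And>i t. (r' i has_vector_derivative
         acceleration \<kappa> m (\<lambda>j. rotation j t) (\<lambda>j. r' j t) i) (at t)"
      by blast
    \<comment> \<open>Uniqueness of derivatives removes the existential choice of the
      velocity.\<close>
    have "r' = rotation_velocity"
      using r'(1) rotation_has_vector_derivative vector_derivative_unique_at by blast
    then show ?R
      using r'(2) rotation_velocity_has_vector_derivative vector_derivative_unique_at by blast
  next
    assume ?R
    then show ?L
      using rotation_has_vector_derivative rotation_velocity_has_vector_derivative
      by (intro exI[of _ rotation_velocity]) simp
  qed
  have acc: "?acc i t = ?w i t \<longleftrightarrow> radial_force i = \<alpha>\<^sup>2 \<and> tangential_force i = 0" for i t
  proof
    assume eq: "?acc i t = ?w i t"
    have "sqrt \<bar>\<kappa>\<bar> - \<kappa> * v > 0"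
      using assms(1) mult_neg_pos[OF assms(1,2)] by (smt (verit) real_sqrt_ge_zero abs_ge_zero)
    moreover have "(sqrt \<bar>\<kappa>\<bar> - \<kappa> * v) * \<rho>\<^sup>2 * (\<alpha>\<^sup>2 - radial_force i) = 0"
      using eq unfolding acceleration_rotation by (simp add: vec_eq_iff forall_3)
    ultimately have E: "radial_force i = \<alpha>\<^sup>2" using assms(3) by simp
    \<comment> \<open>Once the radial sum is \<open>\<alpha>\<^sup>2\<close>, the terms in \<kappa>
      cancel and leave exactly the centripetal acceleration. Sine and cosine have no common zero, so
      the tangential sum must vanish.\<close>
    have "\<rho> * sin (\<alpha> * t + a i) * tangential_force i = 0"
      "\<rho> * cos (\<alpha> * t + a i) * tangential_force i = 0"
      using eq unfolding acceleration_rotation E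
      by (simp_all add: vec_eq_iff forall_3 algebra_simps)
    then have "tangential_force i = 0"
      using assms(3) sin_zero_abs_cos_one by fastforce
    with E show "radial_force i = \<alpha>\<^sup>2 \<and> tangential_force i = 0" by simp
  next
    assume "radial_force i = \<alpha>\<^sup>2 \<and> tangential_force i = 0"
    then show "?acc i t = ?w i t"
      unfolding acceleration_rotation by (simp add: vec_eq_iff forall_3 algebra_simps)
  qed
  show ?thesis
    unfolding three_body_solution_def der acc inj using hyp by simp
qed

lemma ldist_rotation:
  "ldist (rotation i t) (rotation j t) = sqrt (2 * \<rho>\<^sup>2 * (1 - cos (a i - a j)))"
  by (simp add: rotation_def ldist_circle_point)

end

section \<open>Force balance in an isosceles triangle\<close>

lemma UNIV_3_eq:
  fixes i j k :: 3
  assumes "i \<noteq> j" "j \<noteq> k" "i \<noteq> k"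
  shows "UNIV = {i, j, k}"
proof (rule card_subset_eq[symmetric])
  show "card {i, j, k} = card (UNIV :: 3 set)" using assms by simp
qed auto

lemma Diff_singleton_3_eq:
  fixes i j k :: 3
  assumes "i \<noteq> j" "j \<noteq> k" "i \<noteq> k"
  shows "UNIV - {i} = {j, k}"
  unfolding UNIV_3_eq[OF assms] using assms by auto

text \<open>Body \<open>i\<close> is the apex. The balance is evaluated at \<open>i\<close> and at
  the base body \<open>j\<close>, whose mirror image is \<open>k\<close>.\<close>

lemma isosceles_forces:
  fixes i j k :: 3
  assumes "\<kappa> < 0" "\<rho> > 0" "\<And>i. m i > 0" "\<alpha> \<noteq> 0"
    and neq: "i \<noteq> j" "j \<noteq> k" "i \<noteq> k"
    and noncoll: "\<And>i j. i \<noteq> j \<Longrightarrow> cos (a i - a j) \<noteq> 1"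
    and rad: "\<And>i. radial_force \<kappa> \<rho> m a i = \<alpha>\<^sup>2"
    and tan: "\<And>i. tangential_force \<kappa> \<rho> m a i = 0"
    and iso: "cos (a i - a j) = cos (a i - a k)"
  shows "cos (a i - a j) = - 1 / 2" "cos (a j - a k) = - 1 / 2" "m i = m j" "m j = m k"
proof -
  define x y where "x = cos (a j - a i)" and "y = sin (a j - a i)"
  have cos_sym: "cos (a p - a q) = cos (a q - a p)" for p q
    using cos_minus[of "a p - a q"] by simp
  have sin_sym: "sin (a p - a q) = - sin (a q - a p)" for p q
    using sin_minus[of "a p - a q"] by simp
  have xy: "x\<^sup>2 + y\<^sup>2 = 1" by (simp add: x_def y_def)
  have xk: "cos (a k - a i) = x" using iso cos_sym by (simp add: x_def)
  have cjk: "cos (a j - a k) = x * x + y * sin (a k - a i)"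
    using cos_diff[of "a j - a i" "a k - a i"] by (simp add: x_def y_def xk[unfolded x_def])
  \<comment> \<open>Equal cosines leave the sines equal up to sign, and equal sines would make
    \<open>j\<close> and \<open>k\<close> collide. So the base bodies lie at opposite angles from
    the apex.\<close>
  have yk: "sin (a k - a i) = - y"
  proof -
    have "(sin (a k - a i))\<^sup>2 = y\<^sup>2"
      using xy sin_cos_squared_add[of "a k - a i"] by (simp add: xk)
    moreover have "sin (a k - a i) \<noteq> y"
      using cjk xy noncoll[OF neq(2)] by (auto simp: power2_eq_square)
    ultimately show ?thesis by (auto simp: power2_eq_iff)
  qed
  have cjk': "cos (a j - a k) = 2 * x\<^sup>2 - 1"
    using cjk xy by (simp add: yk power2_eq_square)
  have skj: "sin (a k - a j) = - 2 * x * y"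
    using sin_diff[of "a k - a i" "a j - a i"] by (simp add: xk yk x_def y_def)
  have x1: "x \<noteq> 1" using noncoll[OF neq(1)[symmetric]] by (simp add: x_def)
  have y0: "y \<noteq> 0"
    using cjk' xy noncoll[OF neq(2)] by auto
  \<comment> \<open>\<open>d\<close> belongs to the two legs and \<open>d'\<close> to the base,
    whose angle is twice that of a leg.\<close>
  define d d' where "d = radial_denom \<kappa> (2 * \<rho>\<^sup>2 * (1 - x))"
    and "d' = radial_denom \<kappa> (2 * \<rho>\<^sup>2 * (1 - (2 * x\<^sup>2 - 1)))"
  have x_lt: "x < 1" using x1 cos_le_one[of "a j - a i"] unfolding x_def by linarith
  have "y\<^sup>2 > 0" using y0 by simp
  then have "x\<^sup>2 < 1" using xy by linarith
  then have pos: "d > 0" "d' > 0"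
    unfolding d_def d'_def using x_lt assms(1,2) by (auto intro!: radial_denom_pos mult_pos_pos)
  have sets: "UNIV - {i} = {j, k}" "UNIV - {j} = {i, k}"
    using Diff_singleton_3_eq neq by metis+
  have D: "pair_denom \<kappa> \<rho> a i j = d" "pair_denom \<kappa> \<rho> a i k = d" "pair_denom \<kappa> \<rho> a j i = d"
    "pair_denom \<kappa> \<rho> a j k = d'"
    using cjk' xk cos_sym by (simp_all add: pair_denom_def d_def d'_def x_def)
  have "m j * y / d - m k * y / d = 0"
    using tan[of i] neq unfolding tangential_force_def sets by (simp add: D yk) (simp add: y_def)
  then have mjk: "m j = m k" using y0 pos by (simp add: field_simps)
  have "m i * (- y) / d + m k * (- 2 * x * y) / d' = 0"
    using tan[of j] neq unfolding tangential_force_def sets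
    by (simp add: D skj) (simp add: y_def sin_sym[of i j])
  then have "y * (m i * d' + 2 * m j * x * d) = 0"
    using pos mjk by (simp add: field_simps)
  then have mi: "m i * d' = - 2 * m j * x * d" using y0 by simp
  have "m j * (1 - x) / d + m k * (1 - x) / d = \<alpha>\<^sup>2"
    using rad[of i] neq unfolding radial_force_def sets
    by (simp add: D cos_sym[of i] xk) (simp add: x_def)
  moreover have "m i * (1 - x) / d + m k * (1 - (2 * x\<^sup>2 - 1)) / d' = \<alpha>\<^sup>2"
    using rad[of j] neq unfolding radial_force_def sets
    by (simp add: D cjk') (simp add: x_def)
  ultimately have "(m j * (1 - x) + m j * (1 - x) - m i * (1 - x)) / d
      = m j * (1 - (2 * x\<^sup>2 - 1)) / d'"
    unfolding mjk diff_divide_distrib[of _ _ d] add_divide_distrib[of _ _ d] by linarith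
  then have "2 * m j * (1 - x) * d' = m i * d' * (1 - x) + 2 * m j * (1 - x\<^sup>2) * d"
    using pos by (simp add: frac_eq_eq algebra_simps)
  \<comment> \<open>Substituting \<open>mi\<close> eliminates the apex mass, and
    \<open>(1 - x\<^sup>2) - x * (1 - x) = 1 - x\<close> brings out the common factor.\<close>
  then have "2 * m j * (1 - x) * (d' - d) = 0"
    unfolding mi by (simp add: algebra_simps power2_eq_square)
  then have dd: "d = d'" using assms(3)[of j] x1 by simp
  \<comment> \<open>Strict monotonicity makes \<open>radial_denom\<close> injective, so equal
    denominators mean that leg and base are equally long.\<close>
  have "1 - x = 1 - (2 * x\<^sup>2 - 1)"
  proof (rule ccontr)
    assume ne: "1 - x \<noteq> 1 - (2 * x\<^sup>2 - 1)"
    have "2 * \<rho>\<^sup>2 * (1 - x) < 2 * \<rho>\<^sup>2 * (1 - (2 * x\<^sup>2 - 1)) \<or>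
        2 * \<rho>\<^sup>2 * (1 - (2 * x\<^sup>2 - 1)) < 2 * \<rho>\<^sup>2 * (1 - x)"
      using ne assms(2) by (auto simp: neq_iff)
    moreover have "0 \<le> 2 * \<rho>\<^sup>2 * (1 - x)" "0 \<le> 2 * \<rho>\<^sup>2 * (1 - (2 * x\<^sup>2 - 1))"
      using x_lt \<open>x\<^sup>2 < 1\<close> by auto
    ultimately have "d < d' \<or> d' < d"
      unfolding d_def d'_def using radial_denom_strict_mono[OF assms(1)] by blast
    then show False using dd by simp
  qed
  \<comment> \<open>The root \<open>x = 1\<close> is a collision with the apex; the other root is
    the equilateral angle.\<close>
  then have "(x - 1) * (2 * x + 1) = 0" by (simp add: algebra_simps power2_eq_square)
  then have x: "x = - 1 / 2" using x1 by simp
  show "cos (a i - a j) = - 1 / 2" using x cos_sym by (simp add: x_def)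
  show "cos (a j - a k) = - 1 / 2" by (simp add: cjk' x power2_eq_square)
  show "m j = m k" by (rule mjk)
  show "m i = m j" using mi pos by (simp add: dd x)
qed

section \<open>Existence of equal-mass Lagrangian solutions at every height\<close>

lemma cos_sin_2pi3: "cos (2 * pi / 3) = - 1 / 2" "sin (2 * pi / 3) = sqrt 3 / 2"
  using cos_minus_pi[of "pi/3"] cos_pi_minus[of "pi/3"] sin_pi_minus[of "pi/3"]
  by (simp_all add: cos_60 sin_60 field_simps)

lemma lagrangian_rotation_exists:
  assumes "\<kappa> < 0" "v > 0" "\<And>i. m i > 0" "m 1 = m 2" "m 2 = m 3"
  shows "\<exists>r. parallel_relative_equilibrium \<kappa> m v r \<and> lagrangian r"
proof -
  define \<rho> where "\<rho> = sqrt (v\<^sup>2 + 2 / sqrt \<bar>\<kappa>\<bar> * v)"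
  \<comment> \<open>The vertices of an equilateral triangle; the last branch is body
    \<open>3\<close>.\<close>
  define a :: "3 \<Rightarrow> real" where "a i =
    (if i = 1 then 0 else if i = 2 then 2 * pi / 3 else - (2 * pi / 3))" for i
  define D where "D = radial_denom \<kappa> (2 * \<rho>\<^sup>2 * (3 / 2))"
  \<comment> \<open>Each of the two other bodies contributes \<open>m 1 * (3 / 2) / D\<close> to the
    radial sum, where \<open>3 / 2\<close> is \<open>1 - cos (2 * pi / 3)\<close>.\<close>
  define \<alpha> where "\<alpha> = sqrt (3 * m 1 / D)"
  have "v\<^sup>2 + 2 / sqrt \<bar>\<kappa>\<bar> * v > 0" using assms by (intro add_pos_pos) auto
  then have \<rho>: "\<rho> > 0" "\<rho>\<^sup>2 = v\<^sup>2 + 2 / sqrt \<bar>\<kappa>\<bar> * v" by (auto simp: \<rho>_def)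
  have D: "D > 0" unfolding D_def using \<rho>(1) assms(1) by (intro radial_denom_pos) auto
  then have \<alpha>: "\<alpha> \<noteq> 0" "\<alpha>\<^sup>2 = 3 * m 1 / D" using assms(3)[of 1] by (auto simp: \<alpha>_def)
  \<comment> \<open>This angle is the difference \<open>a 2 - a 3\<close>.\<close>
  have cs: "cos (4 * pi / 3) = - 1 / 2" "sin (4 * pi / 3) = - sqrt 3 / 2"
    using cos_double[of "2 * pi / 3"] sin_double[of "2 * pi / 3"]
    by (simp_all add: cos_sin_2pi3 power2_eq_square)
  have cos: "cos (a i - a j) = - 1 / 2" if "i \<noteq> j" for i j
    using that exhaust_3[of i] exhaust_3[of j] by (auto simp: a_def cos_sin_2pi3 cs)
  have den: "pair_denom \<kappa> \<rho> a i j = D" if "i \<noteq> j" for i j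
    using cos[OF that] by (simp add: pair_denom_def D_def)
  have sets: "UNIV - {1} = {2, 3::3}" "UNIV - {2} = {1, 3::3}" "UNIV - {3} = {1, 2::3}"
    by (rule Diff_singleton_3_eq; simp)+
  have all: "P i" if "P 1" "P 2" "P 3" for P and i :: 3
    using that exhaust_3[of i] by auto
  have rad: "radial_force \<kappa> \<rho> m a i = \<alpha>\<^sup>2" for i
    by (rule all[of _ i]) (simp_all add: radial_force_def sets den cos \<alpha> assms(4,5))
  have sin: "sin (a 2 - a 1) = sqrt 3 / 2" "sin (a 3 - a 1) = - sqrt 3 / 2"
    "sin (a 1 - a 2) = - sqrt 3 / 2" "sin (a 3 - a 2) = sqrt 3 / 2"
    "sin (a 1 - a 3) = sqrt 3 / 2" "sin (a 2 - a 3) = - sqrt 3 / 2"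
    using sin_minus[of "4 * pi / 3"] by (simp_all add: a_def cos_sin_2pi3 cs)
  have tan: "tangential_force \<kappa> \<rho> m a i = 0" for i
    by (rule all[of _ i]) (simp_all add: tangential_force_def sets den sin assms(4,5))
  let ?r = "rotation v \<rho> \<alpha> a"
  have "three_body_solution \<kappa> m ?r"
    using three_body_solution_rotation_iff[OF assms(1,2) \<rho>, of m \<alpha> a] rad tan cos by auto
  then have "parallel_relative_equilibrium \<kappa> m v ?r"
    unfolding parallel_relative_equilibrium_def
    using assms(2) \<alpha>(1) \<rho> by (auto simp: rotation_def circle_point_def)
  moreover have "lagrangian ?r"
    unfolding lagrangian_def ldist_rotation by (simp add: cos)
  ultimately show ?thesis by blast
qed

section \<open>From isosceles to equilateral motions\<close>

lemma isosceles_imp_lagrangian: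
  assumes "\<kappa> < 0" "\<And>i. m i > 0" "parallel_relative_equilibrium \<kappa> m v r" "isosceles r"
  shows "lagrangian r \<and> m 1 = m 2 \<and> m 2 = m 3"
proof -
  obtain \<alpha> \<rho> a where sol: "three_body_solution \<kappa> m r" and v: "v > 0" and \<alpha>: "\<alpha> \<noteq> 0"
    and \<rho>: "\<rho> > 0" "\<rho>\<^sup>2 = v\<^sup>2 + 2 / sqrt \<bar>\<kappa>\<bar> * v"
    and "\<And>i t. r i t = vector [\<rho> * cos (\<alpha> * t + a i), \<rho> * sin (\<alpha> * t + a i), v]"
    using assms(3) unfolding parallel_relative_equilibrium_def by blast
  then have r: "r = rotation v \<rho> \<alpha> a"
    by (intro ext) (simp add: rotation_def circle_point_def)
  have noncoll: "\<And>i j. i \<noteq> j \<Longrightarrow> cos (a i - a j) \<noteq> 1"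
    and rad: "\<And>i. radial_force \<kappa> \<rho> m a i = \<alpha>\<^sup>2" and tan: "\<And>i. tangential_force \<kappa> \<rho> m a i = 0"
    using sol three_body_solution_rotation_iff[OF assms(1) v \<rho>] unfolding r by blast+
  \<comment> \<open>The apex in \<open>isosceles\<close> may vary with time, but the instant 0
    suffices because the angle differences are constant.\<close>
  obtain i j k where neq: "i \<noteq> j" "j \<noteq> k" "i \<noteq> k"
    and "ldist (r i 0) (r j 0) = ldist (r i 0) (r k 0)"
    using assms(4) unfolding isosceles_def by blast
  then have iso: "cos (a i - a j) = cos (a i - a k)"
    using \<rho>(1) unfolding r ldist_rotation by simp
  note forces = isosceles_forces[OF assms(1) \<rho>(1) assms(2) \<alpha> neq noncoll rad tan iso]
  have all: "p \<in> {i, j, k}" for p using UNIV_3_eq[OF neq] by auto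
  have sym: "cos (a p - a q) = cos (a q - a p)" for p q
    using cos_minus[of "a p - a q"] by simp
  have cos: "cos (a p - a q) = - 1 / 2" if "p \<noteq> q" for p q
    using that all[of p] all[of q] forces(1,2) iso sym by auto
  have mass: "m p = m q" for p q
    using all[of p] all[of q] forces(3,4) by auto
  have "lagrangian r"
    unfolding lagrangian_def r ldist_rotation by (simp add: cos)
  then show ?thesis using mass by blast
qed

theorem theorem4:
  fixes \<kappa> :: real
  assumes "\<kappa> < 0"
  shows "(\<forall>m v r. (\<forall>i. m i > 0) \<and> parallel_relative_equilibrium \<kappa> m v r \<and> isosceles r
            \<longrightarrow> lagrangian r \<and> m 1 = m 2 \<and> m 2 = m 3) \<and>
         (\<forall>m v. (\<forall>i. m i > 0) \<and> m 1 = m 2 \<and> m 2 = m 3 \<and> v > 0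
            \<longrightarrow> (\<exists>r. parallel_relative_equilibrium \<kappa> m v r \<and> lagrangian r))"
  using isosceles_imp_lagrangian[OF assms] lagrangian_rotation_exists[OF assms] by blast

end
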